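(* For every integer $n\ge 1$, $$B_{2n}=\frac{n}{1-2^{2n}}\sum_{k=1}^{n}\frac{1}{2^k\,k}\sum_{r=0}^{k}\frac{(-1)^r}{2^r}\binom{k}{r}\sum_{j=0}^{k-r}\frac{(-1)^j}{2^j}\binom{k-r}{j}(r-j)^{2n}.$$
   Context: The Bernoulli numbers $B_m$ are defined by $\frac{x}{e^x-1}=\sum_{m=0}^\infty B_m\frac{x^m}{m!}$ for $|x|<2\pi$. *)

theory Defs
  imports "HOL-Complex_Analysis.Complex_Analysis"
begin

text \<open>
  The point \<open>x = 0\<close>, where \<open>x / (exp x - 1)\<close> has a removable singularity but \<open>0 / 0 = 0\<close> in HOL,
  is left out of the defining expansion. Existence and uniqueness of the sequence, which make the
  description well defined, are \<open>bernoulli_seq_ex1\<close> below.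
\<close>

definition bernoulli_seq :: "(nat \<Rightarrow> real) \<Rightarrow> bool" where
  "bernoulli_seq B \<longleftrightarrow>
     (\<forall>x::real. x \<noteq> 0 \<longrightarrow> \<bar>x\<bar> < 2 * pi \<longrightarrow>
        (\<lambda>m. B m * (x ^ m / fact m)) sums (x / (exp x - 1)))"

definition bernoulli :: "nat \<Rightarrow> real" where
  "bernoulli = (THE B. bernoulli_seq B)"

lemma bernoulli_seq_exists: "\<exists>B. bernoulli_seq B"
proof -
  define g :: "complex \<Rightarrow> complex"
    where "g = (\<lambda>z. if z = 0 then deriv exp 0 else (exp z - exp 0) / (z - 0))"
  have d1: "deriv exp (0::complex) = 1"
    by (intro DERIV_imp_deriv) (auto intro!: derivative_eq_intros)
  have gh: "g holomorphic_on ball 0 (2 * pi)"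
    unfolding g_def by (rule pole_lemma) (auto intro!: holomorphic_intros)
  have nz: "g z \<noteq> 0" if z: "z \<in> ball 0 (2 * pi)" for z
  proof (cases "z = 0")
    case True
    then show ?thesis by (simp add: g_def d1)
  next
    case False
    have "exp z \<noteq> 1"
    proof
      assume "exp z = 1"
      then obtain n :: int where n: "Re z = 0" "Im z = of_int (2 * n) * pi"
        by (auto simp: exp_eq_1)
      with False have "n \<noteq> 0" by (auto simp: complex_eq_iff)
      then have "1 \<le> \<bar>real_of_int n\<bar>" by linarith
      then have "2 * pi \<le> \<bar>Im z\<bar>" by (simp add: n abs_mult)
      also have "\<dots> \<le> norm z" by (rule abs_Im_le_cmod)
      finally show False using z by simp
    qed
    with False show ?thesis by (simp add: g_def)
  qed
  define f where "f = (\<lambda>z. 1 / g z)"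
  have fh: "f holomorphic_on ball 0 (2 * pi)"
    unfolding f_def using gh nz by (intro holomorphic_intros) auto
  define B where "B = (\<lambda>m. Re ((deriv ^^ m) f 0))"
  have "(\<lambda>m. B m * (x ^ m / fact m)) sums (x / (exp x - 1))"
    if x: "x \<noteq> 0" "\<bar>x\<bar> < 2 * pi" for x
  proof -
    have "(\<lambda>m. (deriv ^^ m) f 0 / fact m * (of_real x - 0) ^ m) sums f (of_real x)"
      using x by (intro holomorphic_power_series[OF fh]) auto
    then have "(\<lambda>m. Re ((deriv ^^ m) f 0 / fact m * (of_real x - 0) ^ m)) sums Re (f (of_real x))"
      by (rule sums_Re)
    moreover have "Re ((deriv ^^ m) f 0 / fact m * (of_real x - 0) ^ m) = B m * (x ^ m / fact m)" for m
    proof -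
      have "(deriv ^^ m) f 0 / fact m * (of_real x - 0) ^ m
              = of_real (x ^ m / fact m) * (deriv ^^ m) f 0" by simp
      then show ?thesis unfolding B_def
        by (simp only: Re_complex_of_real Im_complex_of_real times_complex.sel) simp
    qed
    moreover have "f (of_real x) = of_real (x / (exp x - 1))"
      using x by (simp add: f_def g_def exp_of_real)
    ultimately show ?thesis by simp
  qed
  then show ?thesis unfolding bernoulli_seq_def by blast
qed

lemma bernoulli_seq_unique:
  assumes "bernoulli_seq B" "bernoulli_seq C"
  shows "B = C"
proof
  fix n
  define d where "d = (\<lambda>m. (B m - C m) / fact m)"
  have d: "(\<lambda>m. d m * x ^ m) sums 0" if "x \<noteq> 0" "\<bar>x\<bar> < 2 * pi" for x
  proof -
    have "(\<lambda>m. B m * (x ^ m / fact m)) sums (x / (exp x - 1))"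
         "(\<lambda>m. C m * (x ^ m / fact m)) sums (x / (exp x - 1))"
      using that assms unfolding bernoulli_seq_def by blast+
    from sums_diff[OF this] show ?thesis
      by (simp add: d_def diff_divide_distrib left_diff_distrib)
  qed
  have "d n = 0"
  proof (induction n rule: less_induct)
    case (less n)
    have "(\<lambda>m. d (m + n) * x ^ m) sums 0" if x: "x \<noteq> 0" "norm x < 2 * pi" for x
    proof -
      have "(\<lambda>m. d (m + n) * x ^ (m + n)) sums (0 - (\<Sum>i<n. d i * x ^ i))"
        using d[of x] x by (intro sums_split_initial_segment) auto
      then have "(\<lambda>m. d (m + n) * x ^ (m + n)) sums 0"
        using less by simp
      then have "(\<lambda>m. d (m + n) * x ^ (m + n) / x ^ n) sums (0 / x ^ n)"
        by (rule sums_divide)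
      then show ?thesis using x by (simp add: power_add)
    qed
    then have "((\<lambda>_. 0) \<longlongrightarrow> d (0 + n)) (at (0::real))"
      by (intro powser_limit_0_strong[where s = "2 * pi" and a = "\<lambda>m. d (m + n)"]) auto
    from LIM_unique[OF this tendsto_const] show ?case by simp
  qed
  then show "B n = C n" by (simp add: d_def)
qed

lemma bernoulli_seq_ex1: "\<exists>!B. bernoulli_seq B"
  using bernoulli_seq_exists bernoulli_seq_unique by blast

lemma bernoulli_seq_bernoulli: "bernoulli_seq bernoulli"
  unfolding bernoulli_def using bernoulli_seq_ex1 by (rule theI')

end

theory Submission
  imports Defs
begin

text \<open>
  Put \<open>C = 1 - cosh x\<close>. Expanding \<open>C ^ k = ((1 - e\<^sup>-\<^sup>x / 2) - e\<^sup>x / 2) ^ k\<close> by the binomial theorem twice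
  produces exponentials \<open>e\<^bsup>(r - j) x\<^esup>\<close>, so the two inner sums of the formula are the coefficient of
  \<open>x\<^bsup>2n\<^esup> / (2n)!\<close> in \<open>C ^ k\<close> (\<open>one_minus_cosh_power_nth\<close>). The outer sum is then that coefficient
  in the first \<open>n\<close> terms of the series
  \<open>(\<Sum>k\<ge>1. (C / 2) ^ k / k) = - ln (1 - C / 2) = - ln ((1 + cosh x) / 2) = - 2 ln (cosh (x / 2))\<close>.
  The omitted terms do not matter, because \<open>C\<close> starts with \<open>x\<^sup>2\<close> and hence \<open>C ^ k\<close> with \<open>x\<^bsup>2k\<^esup>\<close>.

  The derivative of this logarithm is \<open>- tanh (x / 2)\<close>, and the Bernoulli numbers enter because
  \<open>B(x) = x / (e\<^sup>x - 1)\<close> satisfies \<open>B(x) - B(2x) = x / (e\<^sup>x + 1)\<close>, that is,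
  \<open>x tanh (x / 2) = x - 2 (B(x) - B(2x))\<close> (\<open>X_tanh_half\<close>). The factor \<open>1 - 2\<^bsup>2n\<^esup>\<close> is the coefficient
  of \<open>B(x) - B(2x)\<close> relative to that of \<open>B(x)\<close>.

  Everything takes place in the ring of formal power series, with the logarithm replaced by its
  partial sums and the quotients cleared of denominators. Analysis is needed only once, to turn the
  pointwise expansion that defines the Bernoulli numbers into an identity of formal series.
\<close>

section \<open>The Bernoulli generating function as a formal power series\<close>

text \<open>
  Dividing a nonzero series by its lowest power of \<open>x\<close> leaves a function that is continuous at \<open>0\<close>
  with a nonzero value there, whereas the zero function divided by that power vanishes off \<open>0\<close>.
\<close>

lemma has_fps_expansion_0_imp_eq_0:
  fixes F :: "'a :: {banach, real_normed_field} fps"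
  assumes "(\<lambda>_. 0) has_fps_expansion F"
  shows "F = 0"
proof (rule ccontr)
  assume "F \<noteq> 0"
  define c where "c = F $ subdegree F"
  have "(\<lambda>x. if x = 0 then c else 0 / x ^ subdegree F) has_fps_expansion fps_shift (subdegree F) F"
    using assms by (rule has_fps_expansion_shift) (simp_all add: c_def)
  from has_fps_expansion_imp_continuous[OF this, of UNIV]
  have "((\<lambda>x. if x = 0 then c else 0 / x ^ subdegree F) \<longlongrightarrow> c) (at 0)"
    by (simp add: continuous_within)
  then have "((\<lambda>_. 0) \<longlongrightarrow> c) (at (0::'a))"
    by (rule Lim_transform_eventually) (simp add: eventually_at_filter)
  then have "c = 0"
    by (simp add: tendsto_const_iff)
  then show False
    using \<open>F \<noteq> 0\<close> by (simp add: c_def)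
qed

lemma has_fps_expansion_unique:
  fixes F G :: "'a :: {banach, real_normed_field} fps"
  assumes "f has_fps_expansion F" "f has_fps_expansion G"
  shows "F = G"
  using has_fps_expansion_0_imp_eq_0[of "F - G"] has_fps_expansion_diff[OF assms] by simp

definition bernoulli_fps :: "real fps" where
  "bernoulli_fps = Abs_fps (\<lambda>m. bernoulli m / fact m)"

lemma bernoulli_fps_nth: "bernoulli_fps $ m = bernoulli m / fact m"
  by (simp add: bernoulli_fps_def)

text \<open>
  Multiplying by \<open>exp x - 1\<close> also repairs the point \<open>x = 0\<close>, about which the defining expansion says
  nothing: both sides vanish there.
\<close>

lemma bernoulli_fps_times_exp_minus_1: "bernoulli_fps * (fps_exp 1 - 1) = fps_X"
proof -
  have sums: "(\<lambda>m. bernoulli_fps $ m * x ^ m) sums (x / (exp x - 1))"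
    if "x \<noteq> 0" "\<bar>x\<bar> < 2 * pi" for x
    using bernoulli_seq_bernoulli that
    by (simp add: bernoulli_seq_def bernoulli_fps_nth)
  (* Any nonzero point inside the disc of radius 2 pi would serve in place of 1. *)
  have "conv_radius (fps_nth bernoulli_fps) \<ge> ereal (norm (1::real))"
    using sums[of 1] pi_gt3 by (intro conv_radius_geI) (auto simp: sums_iff)
  then have "fps_conv_radius bernoulli_fps > 0"
    unfolding fps_conv_radius_def by (rule less_le_trans[rotated]) simp
  then have expansion: "(\<lambda>x. eval_fps bernoulli_fps x * (exp x - 1)) has_fps_expansion
      bernoulli_fps * (fps_exp 1 - 1)"
    by (intro fps_expansion_intros eval_fps_has_fps_expansion)
  have eval_eq: "eval_fps bernoulli_fps x * (exp x - 1) = x" if "\<bar>x\<bar> < 2 * pi" for x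
  proof (cases "x = 0")
    case False
    then show ?thesis
      using sums[of x] that by (simp add: eval_fps_def sums_iff)
  qed simp
  have "eventually (\<lambda>x. x \<in> ball 0 (2 * pi)) (nhds (0::real))"
    by (intro eventually_nhds_in_open) auto
  then have "eventually (\<lambda>x. eval_fps bernoulli_fps x * (exp x - 1) = x) (nhds 0)"
    by eventually_elim (auto intro!: eval_eq)
  then have "(\<lambda>x. x) has_fps_expansion bernoulli_fps * (fps_exp 1 - 1)"
    by (rule has_fps_expansion_cong[OF _ refl, THEN iffD1, OF _ expansion])
  then show ?thesis
    using has_fps_expansion_fps_X by (rule has_fps_expansion_unique)
qed

lemma bernoulli_fps_scaled_times_exp_minus_1:
  "(bernoulli_fps oo (fps_const 2 * fps_X)) * (fps_exp 2 - 1) = fps_const 2 * fps_X"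
proof -
  have "(bernoulli_fps * (fps_exp 1 - 1)) oo (fps_const 2 * fps_X) = fps_const 2 * fps_X"
    unfolding bernoulli_fps_times_exp_minus_1 by simp
  moreover have "fps_exp 1 oo (fps_const 2 * fps_X) = fps_exp (2::real)"
    by (rule fps_ext) (simp add: fps_compose_linear)
  ultimately show ?thesis
    by (simp add: fps_compose_mult_distrib fps_compose_sub_distrib)
qed

text \<open>
  Since \<open>tanh (x / 2) = (e\<^sup>x - 1) / (e\<^sup>x + 1)\<close>, this is the identity
  \<open>x tanh (x / 2) = x - 2 (B(x) - B(2x))\<close>. It follows from
  \<open>x / (e\<^sup>x - 1) - 2x / (e\<^bsup>2x\<^esup> - 1) = x / (e\<^sup>x + 1)\<close>, after multiplication by
  \<open>e\<^bsup>2x\<^esup> - 1 = (e\<^sup>x + 1) (e\<^sup>x - 1)\<close>.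
\<close>

lemma X_tanh_half:
  "(fps_X - 2 * (bernoulli_fps - (bernoulli_fps oo (fps_const 2 * fps_X)))) * (fps_exp 1 + 1) =
     fps_X * (fps_exp 1 - 1)"
proof -
  define U :: "real fps" where "U = fps_exp 1"
  define A where "A = bernoulli_fps"
  define D where "D = bernoulli_fps oo (fps_const 2 * fps_X)"
  have sq: "fps_exp 2 = U * U"
    by (simp add: U_def flip: fps_exp_add_mult)
  have A: "A * (U - 1) = fps_X"
    unfolding A_def U_def by (rule bernoulli_fps_times_exp_minus_1)
  have D: "D * (U * U - 1) = 2 * fps_X"
    using bernoulli_fps_scaled_times_exp_minus_1
    by (simp add: D_def sq numeral_fps_const)
  have "U - 1 \<noteq> 0"
    using A by auto
  moreover have "(fps_X - 2 * (A - D)) * (U + 1) * (U - 1) =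
      fps_X * (U * U - 1) - 2 * (U + 1) * (A * (U - 1)) + 2 * (D * (U * U - 1))"
    by (simp add: algebra_simps)
  then have "(fps_X - 2 * (A - D)) * (U + 1) * (U - 1) = fps_X * (U - 1) * (U - 1)"
    unfolding A D by (simp add: algebra_simps)
  ultimately have "(fps_X - 2 * (A - D)) * (U + 1) = fps_X * (U - 1)"
    by simp
  then show ?thesis
    unfolding A_def D_def U_def .
qed

section \<open>Powers of one minus the hyperbolic cosine\<close>

definition one_minus_cosh :: "real fps" where
  "one_minus_cosh = 1 - fps_const (1/2) * (fps_exp 1 + fps_exp (-1))"

lemma one_minus_cosh_power_nth:
  "(one_minus_cosh ^ k) $ m =
     (\<Sum>r=0..k. (-1) ^ r / 2 ^ r * real (k choose r) *
       (\<Sum>j=0..k-r. (-1) ^ j / 2 ^ j * real ((k - r) choose j) * (real r - real j) ^ m)) / fact m"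
proof -
  (* Splitting off e^x first makes the inner binomial sum range over the powers of e^(-x),
     which is the nesting of the sums over r and j in the statement. *)
  define P :: "real fps" where "P = fps_const (-1/2) * fps_exp 1"
  define Q :: "real fps" where "Q = fps_const (-1/2) * fps_exp (-1)"
  have P: "P ^ r = fps_const ((-1) ^ r / 2 ^ r) * fps_exp (real r)" for r
    by (simp add: P_def power_mult_distrib fps_exp_power_mult fps_const_power flip: power_divide)
  have Q: "Q ^ j = fps_const ((-1) ^ j / 2 ^ j) * fps_exp (- real j)" for j
    by (simp add: Q_def power_mult_distrib fps_exp_power_mult fps_const_power flip: power_divide)
  have PQ: "P ^ r * Q ^ j = fps_const ((-1) ^ r / 2 ^ r * ((-1) ^ j / 2 ^ j)) *
      fps_exp (real r - real j)" for r j
    using fps_exp_add_mult[of "real r" "- real j"]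
    unfolding P Q by (simp add: ac_simps flip: fps_const_mult)
  have eq: "one_minus_cosh = P + (Q + 1)"
    by (rule fps_ext) (simp add: one_minus_cosh_def P_def Q_def field_simps)
  have "one_minus_cosh ^ k = (\<Sum>r\<le>k. of_nat (k choose r) * P ^ r *
      (\<Sum>j\<le>k-r. of_nat ((k - r) choose j) * Q ^ j * 1 ^ (k - r - j)))"
    unfolding eq binomial_ring[of P] binomial_ring[of Q] ..
  also have "\<dots> = (\<Sum>r\<le>k. \<Sum>j\<le>k-r.
      fps_const (real (k choose r) * real ((k - r) choose j)) * (P ^ r * Q ^ j))"
    by (simp add: sum_distrib_left fps_of_nat[symmetric] ac_simps flip: fps_const_mult)
  finally show ?thesis
    unfolding PQ
    by (simp add: fps_sum_nth sum_distrib_left sum_divide_distrib atLeast0AtMost ac_simps)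
qed

lemma one_minus_cosh_power_low_nth:
  assumes "m < 2 * k"
  shows "(one_minus_cosh ^ k) $ m = 0"
proof -
  have "one_minus_cosh $ 0 = 0 \<and> one_minus_cosh $ 1 = 0"
    by (simp add: one_minus_cosh_def)
  then have "one_minus_cosh = 0 \<or> 2 \<le> subdegree one_minus_cosh"
    by (metis One_nat_def less_2_cases_iff not_less nth_subdegree_nonzero)
  then show ?thesis
  proof
    assume "one_minus_cosh = 0"
    then show ?thesis using assms by (cases k) auto
  next
    assume "2 \<le> subdegree one_minus_cosh"
    then have "2 * k \<le> subdegree (one_minus_cosh ^ k)"
      by (simp add: mult.commute)
    then show ?thesis using assms by (intro nth_less_subdegree_zero) linarith
  qed
qed

section \<open>The truncated logarithm\<close>

text \<open>The partial sums of \<open>- ln (1 - C / 2)\<close>, where \<open>C = 1 - cosh x\<close>.\<close>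

definition trunc_log :: "nat \<Rightarrow> real fps" where
  "trunc_log n = (\<Sum>k=1..n. fps_const (1 / (2 ^ k * real k)) * one_minus_cosh ^ k)"

text \<open>
  Differentiating turns the logarithmic sum into a geometric one, so that the derivative is
  \<open>- tanh (x / 2)\<close> up to the factor \<open>1 - (C / 2) ^ n\<close>. The remaining work is to cancel a factor
  \<open>e\<^sup>x + 1\<close>, using \<open>e\<^sup>x (2 + e\<^sup>x + e\<^sup>-\<^sup>x) = (e\<^sup>x + 1)\<^sup>2\<close>.
\<close>

lemma deriv_trunc_log:
  "fps_deriv (trunc_log n) * (fps_exp 1 + 1) =
     - (fps_exp 1 - 1) * (1 - (fps_const (1/2) * one_minus_cosh) ^ n)"
proof -
  define U :: "real fps" where "U = fps_exp 1"
  define V :: "real fps" where "V = fps_exp (-1)"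
  define H where "H = fps_const (1/2) * one_minus_cosh"
  have UV: "U * V = 1"
    by (simp add: U_def V_def flip: fps_exp_add_mult)
  have H: "4 * H = 2 - U - V"
    unfolding H_def one_minus_cosh_def U_def V_def
    by (rule fps_ext) (simp add: numeral_fps_const field_simps)
  have H': "4 * fps_deriv H = V - U"
    using arg_cong[OF H, of fps_deriv] by (simp add: U_def V_def flip: fps_const_neg)
  have "trunc_log n = (\<Sum>k=1..n. fps_const (1 / real k) * H ^ k)"
    unfolding trunc_log_def H_def
    by (intro sum.cong) (auto simp: power_mult_distrib fps_const_power power_divide mult.assoc[symmetric])
  then have "fps_deriv (trunc_log n) = (\<Sum>k=1..n. fps_deriv H * H ^ (k - 1))"
    by (auto simp: fps_deriv_sum fps_deriv_power mult.assoc[symmetric] intro!: sum.cong)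
  also have "\<dots> = fps_deriv H * (\<Sum>i<n. H ^ i)"
    unfolding sum_distrib_left
    by (rule sum.reindex_bij_witness[of _ Suc "\<lambda>k. k - 1"]) auto
  finally have "fps_deriv (trunc_log n) * (1 - H) = fps_deriv H * (1 - H ^ n)"
    by (simp add: one_diff_power_eq ac_simps)
  then have "4 * (fps_deriv (trunc_log n) * (1 - H)) = 4 * (fps_deriv H * (1 - H ^ n))"
    by simp
  then have "fps_deriv (trunc_log n) * (4 - 4 * H) = (4 * fps_deriv H) * (1 - H ^ n)"
    by (simp add: algebra_simps)
  then have "fps_deriv (trunc_log n) * (2 + U + V) = (V - U) * (1 - H ^ n)"
    unfolding H H' by (simp add: algebra_simps)
  then have "fps_deriv (trunc_log n) * (U * (2 + U + V)) = U * (V - U) * (1 - H ^ n)"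
    by (simp add: ac_simps)
  moreover have sq: "U * (2 + U + V) = (U + 1) * (U + 1)"
    and diff: "U * (V - U) = - (U - 1) * (U + 1)"
    using UV by (simp_all add: algebra_simps)
  ultimately have "(fps_deriv (trunc_log n) * (U + 1)) * (U + 1) =
      (- (U - 1) * (1 - H ^ n)) * (U + 1)"
    unfolding sq diff by (simp only: ac_simps)
  moreover have "U + 1 \<noteq> 0"
    by (auto simp: U_def fps_eq_iff intro!: exI[of _ 0])
  ultimately show ?thesis
    unfolding H_def [symmetric] U_def [symmetric] by simp
qed

text \<open>
  Multiplied by \<open>x\<close>, the derivative of the truncated logarithm is \<open>- E + E (C / 2) ^ n\<close> with
  \<open>E = x tanh (x / 2)\<close>. The truncation error \<open>E (C / 2) ^ n\<close> has order greater than \<open>2n\<close>: the power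
  contributes \<open>2n\<close>, and \<open>E\<close> has no constant term. So the coefficient is read off from \<open>E\<close>.
\<close>

lemma trunc_log_nth:
  assumes "n \<ge> 1"
  shows "trunc_log n $ (2 * n) = (1 - 2 ^ (2 * n)) * bernoulli (2 * n) / (real n * fact (2 * n))"
proof -
  define U :: "real fps" where "U = fps_exp 1"
  define H where "H = fps_const (1/2) * one_minus_cosh"
  define E where "E = fps_X - 2 * (bernoulli_fps - (bernoulli_fps oo (fps_const 2 * fps_X)))"
  define L where "L = fps_deriv (trunc_log n)"
  have E: "E * (U + 1) = fps_X * (U - 1)"
    unfolding E_def U_def by (rule X_tanh_half)
  have L: "L * (U + 1) = - (U - 1) * (1 - H ^ n)"
    unfolding L_def U_def H_def by (rule deriv_trunc_log)
  have "U + 1 \<noteq> 0"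
    by (auto simp: U_def fps_eq_iff intro!: exI[of _ 0])
  moreover have "(fps_X * L) * (U + 1) = - (fps_X * (U - 1)) * (1 - H ^ n)"
    unfolding mult.assoc L by (simp add: algebra_simps)
  then have "(fps_X * L) * (U + 1) = (- E + E * H ^ n) * (U + 1)"
    unfolding E [symmetric] by (simp add: algebra_simps)
  ultimately have XL: "fps_X * L = - E + E * H ^ n"
    by simp
  have E0: "E $ 0 = 0"
    by (simp add: E_def numeral_fps_const)
  have "(E * H ^ n) $ (2 * n) = (\<Sum>i=0..2*n. E $ i * (H ^ n) $ (2 * n - i))"
    by (rule fps_mult_nth)
  also have "\<dots> = 0"
  proof (rule sum.neutral, rule ballI)
    fix i assume "i \<in> {0..2*n}"
    show "E $ i * (H ^ n) $ (2 * n - i) = 0"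
    proof (cases "i = 0")
      case False
      then show ?thesis
        using assms
        by (simp add: H_def power_mult_distrib fps_const_power one_minus_cosh_power_low_nth)
    qed (simp add: E0)
  qed
  finally have "(fps_X * L) $ (2 * n) = - (E $ (2 * n))"
    by (simp add: XL)
  also have "\<dots> = 2 * (1 - 2 ^ (2 * n)) * bernoulli (2 * n) / fact (2 * n)"
    using assms
    by (simp add: E_def numeral_fps_const fps_compose_linear bernoulli_fps_nth
        diff_divide_distrib left_diff_distrib right_diff_distrib)
  finally have "2 * real n * trunc_log n $ (2 * n) =
      2 * (1 - 2 ^ (2 * n)) * bernoulli (2 * n) / fact (2 * n)"
    using assms by (simp add: L_def)
  then show ?thesis
    using assms by (simp add: field_simps)
qed

theorem mainTheorem6:
  fixes n :: nat
  assumes "n \<ge> 1"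
  shows "bernoulli (2 * n) =
    real n / (1 - 2 ^ (2 * n)) *
      (\<Sum>k=1..n. 1 / (2 ^ k * real k) *
        (\<Sum>r=0..k. (-1) ^ r / 2 ^ r * real (k choose r) *
          (\<Sum>j=0..k-r. (-1) ^ j / 2 ^ j * real ((k - r) choose j) *
            (real r - real j) ^ (2 * n))))"
    (is "_ = _ * ?S")
proof -
  have "trunc_log n $ (2 * n) = ?S / fact (2 * n)"
    unfolding sum_divide_distrib[of _ "{1..n}"]
    by (simp add: trunc_log_def fps_sum_nth one_minus_cosh_power_nth)
  then have "?S = fact (2 * n) * trunc_log n $ (2 * n)"
    by simp
  then have S: "?S = (1 - 2 ^ (2 * n)) * bernoulli (2 * n) / real n"
    unfolding trunc_log_nth[OF assms] by simp
  define d :: real where "d = 1 - 2 ^ (2 * n)"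
  have "(1::real) < 2 ^ (2 * n)"
    using assms by (intro one_less_power) auto
  then have "d \<noteq> 0"
    unfolding d_def by linarith
  then show ?thesis
    using assms unfolding S d_def [symmetric] by simp
qed

end
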